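(* The 2D-HC map $F_{2\mathrm D}\colon[0,1]^2\to[0,1]^2$ and the 3D-HC map $F\colon[0,1]^3\to[0,1]^3$ are ergodic.
   Context: **Maps.** Define $\tau\colon[0,1]\to[0,1]$ by $\tau(x)=3x \bmod 1$ for $0\le x<1$ and $\tau(1)=1$. Let $A=[0,\frac13)\times[0,1]\times[0,1]$, $B=[\frac23,1]\times[0,1]\times[0,\frac12)$, $C=[\frac23,1]\times[0,1]\times[\frac12,1]$, $D=[\frac13,\frac23)\times[0,1]\times[0,1]$. The 3D-HC map $F\colon[0,1]^3\to[0,1]^3$ is $F(x,y,z)=(\tau(x),\frac23y,\frac12z)$ on $A$; $F(x,y,z)=(\tau(x),\frac23+\frac16y,2z)$ on $B$; $F(x,y,z)=(\tau(x),\frac56+\frac16y,-1+2z)$ on $C$; $F(x,y,z)=(\tau(x),\frac23y,\frac12+\frac12z)$ on $D$. The 2D-HC map $F_{2\mathrm D}\colon[0,1]^2\to[0,1]^2$ is $F_{2\mathrm D}(x,z)=\pi(F(x,0,z))$, where $\pi(x,y,z)=(x,z)$. **Ergodicity.** A map $G\colon M\to M$ with $M=[0,1]^2$ or $M=[0,1]^3$ is called ergodic if for each continuous function $\phi\colon M\to\mathbb R$ the trajectory average $\langle\phi\rangle(p)=\lim_{n\to\infty}\frac1n\sum_{i=0}^{n-1}\phi(G^i(p))$ exists and takes the same value for almost every initial point $p\in M$, where "almost every" refers to Lebesgue measure (area, resp. volume). *)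

theory Defs
  imports "HOL-Analysis.Analysis"
begin

definition unit_square :: "(real \<times> real) set" where
  "unit_square = {0..1} \<times> {0..1}"

definition unit_cube :: "(real \<times> real \<times> real) set" where
  "unit_cube = {0..1} \<times> {0..1} \<times> {0..1}"

definition tau :: "real \<Rightarrow> real" where
  "tau x = (if x = 1 then 1 else frac (3 * x))"

definition region_A :: "(real \<times> real \<times> real) set" where
  "region_A = {0..<1/3} \<times> {0..1} \<times> {0..1}"

definition region_B :: "(real \<times> real \<times> real) set" where
  "region_B = {2/3..1} \<times> {0..1} \<times> {0..<1/2}"

definition region_C :: "(real \<times> real \<times> real) set" where
  "region_C = {2/3..1} \<times> {0..1} \<times> {1/2..1}"

definition region_D :: "(real \<times> real \<times> real) set" where
  "region_D = {1/3..<2/3} \<times> {0..1} \<times> {0..1}"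

text \<open>The four regions partition the unit cube; outside the cube the map is left unspecified.\<close>

definition hc3 :: "real \<times> real \<times> real \<Rightarrow> real \<times> real \<times> real" where
  "hc3 = (\<lambda>(x, y, z).
     if (x, y, z) \<in> region_A then (tau x, 2/3 * y, 1/2 * z)
     else if (x, y, z) \<in> region_B then (tau x, 2/3 + 1/6 * y, 2 * z)
     else if (x, y, z) \<in> region_C then (tau x, 5/6 + 1/6 * y, - 1 + 2 * z)
     else if (x, y, z) \<in> region_D then (tau x, 2/3 * y, 1/2 + 1/2 * z)
     else undefined)"

definition proj_xz :: "real \<times> real \<times> real \<Rightarrow> real \<times> real" where
  "proj_xz = (\<lambda>(x, y, z). (x, z))"

definition hc2 :: "real \<times> real \<Rightarrow> real \<times> real" where
  "hc2 = (\<lambda>(x, z). proj_xz (hc3 (x, 0, z)))"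

text \<open>Ergodicity in the sense of trajectory averages of continuous functions: the common value
  \<open>c\<close> depends only on \<open>\<phi>\<close>, and no invariance of Lebesgue measure under \<open>G\<close> is assumed.
  The notion includes that \<open>G\<close> is a self-map of \<open>M\<close>.\<close>

definition ergodic_map :: "'a::euclidean_space set \<Rightarrow> ('a \<Rightarrow> 'a) \<Rightarrow> bool" where
  "ergodic_map M G \<longleftrightarrow> G \<in> M \<rightarrow> M \<and>
     (\<forall>\<phi> :: 'a \<Rightarrow> real. continuous_on M \<phi> \<longrightarrow>
       (\<exists>c. AE p in lebesgue_on M.
          (\<lambda>n. 1 / real n * (\<Sum>i<n. \<phi> ((G ^^ i) p))) \<longlonglongrightarrow> c))"

end

theory Submission
  imports Defs "HOL-Probability.Probability_Measure" "HOL-Library.Discrete_Functions"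
begin

text \<open>
  The binary digits of \<open>z\<close> behave as a stack that is operated by the ternary digits of \<open>x\<close>. The
  branches of the map over \<open>[0, 1/3)\<close> and \<open>[1/3, 2/3)\<close> push the digit \<open>0\<close> or \<open>1\<close> in front of the
  expansion of \<open>z\<close>, the branch over \<open>[2/3, 1]\<close> pops its leading digit, and \<open>\<tau>\<close> shifts the expansion
  of \<open>x\<close>, so that the next ternary digit decides the next operation. For a Lebesgue random \<open>x\<close> these
  digits are independent and uniform: pushes outnumber pops two to one, the stack grows, and the
  initial \<open>z\<close> is buried under digits that \<open>x\<close> alone determines. The initial \<open>y\<close> is forgotten as well,
  since every branch contracts \<open>y\<close> and the only choice that \<open>z\<close> makes for \<open>y\<close>, between the halves
  \<open>B\<close> and \<open>C\<close>, is made by the top of the stack.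

  Hence \<open>F\<^sup>m(x, y, z)\<close> is, up to a small error, a function of finitely many ternary digits of \<open>x\<close>. The
  error is bounded by a function \<open>weight m\<close> of the first \<open>m\<close> digits whose mean is \<open>(17/18)\<^sup>m\<close>
  (lemmas \<open>dist_hc3_funpow_le\<close> and \<open>integral_weight\<close>). Let \<open>f x\<close> be the value of \<open>\<phi> \<circ> F\<^sup>m\<close> at a
  reference point chosen by the first \<open>2 m\<close> digits of \<open>x\<close>. Along a trajectory, the average of \<open>\<phi>\<close> then differs
  from the average of \<open>f\<close> along the \<open>\<tau>\<close>-orbit of \<open>x\<close> by little more than a multiple of the average
  of \<open>weight m\<close> along the same orbit.

  Both \<open>f\<close> and \<open>weight m\<close> depend on finitely many digits, and for such functions the averages
  converge almost everywhere to the mean by the strong law of large numbers for the digits (lemma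
  \<open>triadic_step_average\<close>): digits at distant positions are independent, so second moments of the sums
  grow linearly. Consequently, for almost every \<open>x\<close> and for all \<open>y\<close> and all \<open>z < 1\<close>, the trajectory
  averages of \<open>\<phi>\<close> are eventually within any prescribed \<open>\<epsilon>\<close> of a constant that depends on \<open>\<phi>\<close> and
  \<open>\<epsilon>\<close> only (lemma \<open>average_eventually_close\<close>). This forces them to converge, and to the same limit
  (lemma \<open>common_limit\<close>). The two-dimensional map is a factor of the three-dimensional one, so its
  averages are averages for the latter.
\<close>

section \<open>Shared digits\<close>

text \<open>Two numbers in \<open>[0, 1)\<close> satisfy this relation iff their base \<open>b\<close> expansions agree in the first
  \<open>k\<close> digits, that is, iff they lie in the same \<open>b\<close>-adic interval of length \<open>b\<^sup>-\<^sup>k\<close>.\<close>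

definition same_digits :: "nat \<Rightarrow> nat \<Rightarrow> real \<Rightarrow> real \<Rightarrow> bool" where
  "same_digits b k x y \<longleftrightarrow> \<lfloor>real b ^ k * x\<rfloor> = \<lfloor>real b ^ k * y\<rfloor>"

lemma same_digits_0: "x \<in> {0..<1} \<Longrightarrow> y \<in> {0..<1} \<Longrightarrow> same_digits b 0 x y"
  unfolding same_digits_def by (auto simp: floor_eq_iff floor_unique[of 0])

text \<open>On \<open>[0, 1)\<close> the integer \<open>\<lfloor>b\<^sup>k\<^sup>+\<^sup>1 x\<rfloor>\<close> lists the first \<open>k + 1\<close> digits. Its quotient by \<open>b\<^sup>k\<close> is the
  leading digit \<open>\<lfloor>b x\<rfloor>\<close>, and its remainder lists the digits that are left after \<open>x \<mapsto> frac (b x)\<close>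
  has deleted it.\<close>

lemma same_digits_Suc:
  assumes "b > 0" and same: "same_digits b (Suc k) x y"
  shows "\<lfloor>real b * x\<rfloor> = \<lfloor>real b * y\<rfloor>"
    and "same_digits b k (frac (real b * x)) (frac (real b * y))"
proof -
  have lead: "\<lfloor>real b * u\<rfloor> = \<lfloor>real b ^ Suc k * u\<rfloor> div int b ^ k" for u :: real
  proof -
    have "real b * u = (real b ^ Suc k * u) / real_of_int (int b ^ k)"
      using \<open>b > 0\<close> by (simp add: field_simps)
    then show ?thesis
      by (simp only: floor_divide_real_eq_div of_nat_0_le_iff zero_le_power)
  qed
  have rest: "\<lfloor>real b ^ k * frac (real b * u)\<rfloor>
      = \<lfloor>real b ^ Suc k * u\<rfloor> - int b ^ k * \<lfloor>real b * u\<rfloor>" for u :: real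
  proof -
    have "real b ^ k * frac (real b * u)
        = real b ^ Suc k * u - real_of_int (int b ^ k * \<lfloor>real b * u\<rfloor>)"
      by (simp add: frac_def algebra_simps)
    then show ?thesis
      by (simp only: floor_diff_of_int)
  qed
  show "\<lfloor>real b * x\<rfloor> = \<lfloor>real b * y\<rfloor>"
    using same by (simp only: lead same_digits_def)
  then show "same_digits b k (frac (real b * x)) (frac (real b * y))"
    using same by (simp only: rest same_digits_def)
qed

lemma same_digits_dist:
  assumes "b > 0" "same_digits b k x y"
  shows "\<bar>x - y\<bar> \<le> (1 / real b) ^ k"
proof -
  have "\<bar>real b ^ k * x - real b ^ k * y\<bar> < 1"
    using assms(2) unfolding same_digits_def by linarith
  moreover have "\<bar>real b ^ k * x - real b ^ k * y\<bar> = real b ^ k * \<bar>x - y\<bar>"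
    by (metis abs_mult abs_of_nonneg of_nat_0_le_iff right_diff_distrib zero_le_power)
  ultimately show ?thesis
    using \<open>b > 0\<close> by (simp add: field_simps power_divide)
qed

section \<open>The tripling map and its step functions\<close>

text \<open>Equal to \<open>\<tau>\<close> on \<open>[0, 1)\<close>; the value at \<open>1\<close> is \<open>0\<close> instead of \<open>1\<close>, so that the range is
  \<open>[0, 1)\<close>.\<close>

definition T :: "real \<Rightarrow> real" where
  "T x = frac (3 * x)"

abbreviation U :: "real measure" where
  "U \<equiv> restrict_space lborel {0..<1}"

lemma prob_space_U: "prob_space U"
  by (rule prob_spaceI) (simp add: emeasure_restrict_space space_restrict_space)

interpretation U: prob_space U
  by (rule prob_space_U)

lemma measure_U [simp]: "measure U {0..<1} = 1"
  using U.prob_space by (simp add: space_restrict_space)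

lemma T_range: "T x \<in> {0..<1}"
  by (simp add: T_def frac_lt_1)

lemma T_funpow_range: "x \<in> {0..<1} \<Longrightarrow> (T ^^ n) x \<in> {0..<1}"
  by (cases n) (use T_range in auto)

lemma measurable_T_funpow [measurable]: "T ^^ n \<in> measurable U U"
proof -
  have [measurable]: "T \<in> measurable borel borel"
    unfolding T_def frac_def by measurable
  have "T \<in> measurable U U"
    by (rule measurable_restrict_space3) (use T_range in auto)
  then show ?thesis
    by (rule measurable_compose_n)
qed

text \<open>Substitution along the three inverse branches \<open>x \<mapsto> (x + d) / 3\<close> of \<open>T\<close>, each of which has
  derivative \<open>1/3\<close> and fills one third of the interval.\<close>

lemma integral_thirds:
  fixes f :: "real \<Rightarrow> real"
  assumes f: "integrable U f"
  shows "(\<integral>x. f x \<partial>U) = (\<Sum>d<3. \<integral>x. f ((x + real d) / 3) \<partial>U) / 3"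
proof -
  define G where "G d x = indicator {real d / 3..<(real d + 1) / 3} x * (indicator {0..<1} x * f x)"
    for d x
  have int: "integrable lborel (\<lambda>x. indicator {0..<1} x * f x)"
    using f by (simp add: integrable_restrict_space)
  have intG: "integrable lborel (G d)" for d
    unfolding G_def using integrable_mult_indicator[OF _ int] by simp
  have third: "(\<integral>x. f ((x + real d) / 3) \<partial>U) = 3 * (\<integral>x. G d x \<partial>lborel)" if "d < 3" for d
  proof -
    have "(\<integral>x. G d x \<partial>lborel) = (1/3) * (\<integral>x. G d (real d / 3 + (1/3) * x) \<partial>lborel)"
      using lborel_integral_real_affine[of "1/3" "G d" "real d / 3"] by simp
    also have "(\<lambda>x. G d (real d / 3 + (1/3) * x)) = (\<lambda>x. indicator {0..<1} x * f ((x + real d) / 3))"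
      using that by (auto simp: G_def fun_eq_iff indicator_def field_simps)
    finally show ?thesis
      by (simp add: integral_restrict_space)
  qed
  have split: "indicator {0..<1} x * f x = (\<Sum>d<3. G d x)" for x
    by (auto simp: G_def indicator_def eval_nat_numeral)
  have "(\<integral>x. f x \<partial>U) = (\<integral>x. (\<Sum>d<3. G d x) \<partial>lborel)"
    by (simp add: integral_restrict_space split)
  also have "\<dots> = (\<Sum>d<3. \<integral>x. G d x \<partial>lborel)"
    by (rule Bochner_Integration.integral_sum) (rule intG)
  finally show ?thesis
    by (simp add: third flip: sum_distrib_left)
qed

text \<open>The random variables on \<open>[0, 1)\<close> that are determined by the first \<open>k\<close> ternary digits.\<close>

definition triadic_step :: "nat \<Rightarrow> (real \<Rightarrow> real) \<Rightarrow> bool" where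
  "triadic_step k f \<longleftrightarrow> (\<forall>x\<in>{0..<1}. \<forall>y\<in>{0..<1}. same_digits 3 k x y \<longrightarrow> f x = f y)"

lemma triadic_stepD:
  "triadic_step k f \<Longrightarrow> same_digits 3 k x y \<Longrightarrow> x \<in> {0..<1} \<Longrightarrow> y \<in> {0..<1} \<Longrightarrow> f x = f y"
  unfolding triadic_step_def by blast

text \<open>The left end points of the triadic intervals represent all values of a step function. There
  are finitely many of them and they depend measurably on \<open>x\<close>, which gives boundedness and
  measurability of step functions below.\<close>

lemma triadic_step_round:
  assumes "triadic_step k f" "x \<in> {0..<1}"
  shows "f x = f (\<lfloor>3 ^ k * x\<rfloor> / 3 ^ k)" "\<lfloor>3 ^ k * x\<rfloor> \<in> {0..<3 ^ k}"
proof -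
  show fl: "\<lfloor>3 ^ k * x\<rfloor> \<in> {0..<3 ^ k}"
    using assms(2) by (auto simp: floor_less_iff)
  have "real_of_int \<lfloor>3 ^ k * x\<rfloor> < real_of_int (3 ^ k)"
    using fl by (subst of_int_less_iff) auto
  then have "\<lfloor>3 ^ k * x\<rfloor> / 3 ^ k \<in> {0..<1::real}"
    using fl by (auto simp: field_simps)
  moreover have "same_digits 3 k x (\<lfloor>3 ^ k * x\<rfloor> / 3 ^ k)"
    by (simp add: same_digits_def)
  ultimately show "f x = f (\<lfloor>3 ^ k * x\<rfloor> / 3 ^ k)"
    using triadic_stepD[OF assms(1) _ assms(2)] by blast
qed

lemma triadic_step_measurable:
  assumes "triadic_step k f"
  shows "f \<in> borel_measurable U"
proof -
  have "(\<lambda>x::real. f (real_of_int \<lfloor>3 ^ k * x\<rfloor> / 3 ^ k)) \<in> borel_measurable borel"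
    by (rule measurable_compose[where g = "\<lambda>j. f (real_of_int j / 3 ^ k)" and N = "count_space UNIV"])
       measurable
  then have "(\<lambda>x::real. f (real_of_int \<lfloor>3 ^ k * x\<rfloor> / 3 ^ k)) \<in> borel_measurable U"
    by (intro measurable_restrict_space1) simp
  moreover have "f x = f (real_of_int \<lfloor>3 ^ k * x\<rfloor> / 3 ^ k)" if "x \<in> space U" for x
    using that by (intro triadic_step_round[OF assms]) (simp add: space_restrict_space)
  ultimately show ?thesis
    by (subst measurable_cong)
qed

lemma triadic_step_bounded:
  assumes "triadic_step k f"
  obtains B where "\<And>x. x \<in> {0..<1} \<Longrightarrow> \<bar>f x\<bar> \<le> B"
proof
  let ?A = "(\<lambda>j. \<bar>f (real_of_int j / 3 ^ k)\<bar>) ` {0..<3 ^ k}"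
  show "\<bar>f x\<bar> \<le> Max ?A" if "x \<in> {0..<1}" for x
  proof (rule Max_ge)
    show "\<bar>f x\<bar> \<in> ?A"
    proof (rule image_eqI)
      show "\<bar>f x\<bar> = \<bar>f (real_of_int \<lfloor>3 ^ k * x\<rfloor> / 3 ^ k)\<bar>"
        by (rule arg_cong[OF triadic_step_round(1)[OF assms that]])
    qed (rule triadic_step_round(2)[OF assms that])
  qed simp
qed

lemma integrable_U_bounded:
  assumes "f \<in> borel_measurable U" "\<And>x. x \<in> {0..<1} \<Longrightarrow> \<bar>f x\<bar> \<le> (B::real)"
  shows "integrable U f"
  by (rule U.integrable_const_bound[of _ B])
     (use assms in \<open>auto intro!: AE_I2 simp: space_restrict_space\<close>)

lemma integral_U_bounded:
  assumes "f \<in> borel_measurable U" "\<And>x. x \<in> {0..<1} \<Longrightarrow> \<bar>f x\<bar> \<le> (B::real)"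
  shows "\<bar>\<integral>x. f x \<partial>U\<bar> \<le> B"
proof -
  have "\<bar>\<integral>x. f x \<partial>U\<bar> \<le> (\<integral>x. \<bar>f x\<bar> \<partial>U)"
    by (rule integral_abs_bound)
  also have "\<dots> \<le> (\<integral>x. B \<partial>U)"
    by (rule integral_mono)
       (use assms integrable_U_bounded[OF assms] in \<open>auto simp: space_restrict_space\<close>)
  finally show ?thesis
    by simp
qed

text \<open>The first \<open>k\<close> digits, which determine \<open>f\<close>, are independent of the later ones, which determine
  \<open>h \<circ> T\<^sup>k\<close>. The induction removes the first digit: on the third with index \<open>d\<close>, written as
  \<open>(x + d) / 3\<close>, the map \<open>T\<close> returns \<open>x\<close>, and \<open>f\<close> becomes a step function of \<open>x\<close> of level one less.\<close>

lemma decorrelation: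
  fixes f h :: "real \<Rightarrow> real"
  assumes "triadic_step k f" and h: "h \<in> borel_measurable U" "\<And>x. x \<in> {0..<1} \<Longrightarrow> \<bar>h x\<bar> \<le> B"
  shows "(\<integral>x. f x * h ((T ^^ k) x) \<partial>U) = (\<integral>x. f x \<partial>U) * (\<integral>x. h x \<partial>U)"
  using assms(1)
proof (induction k arbitrary: f)
  case 0
  have const: "f x = f 0" if "x \<in> {0..<1}" for x
  proof -
    have "same_digits 3 0 x 0"
      using that by (intro same_digits_0) auto
    then show ?thesis
      by (rule triadic_stepD[OF 0 _ that]) simp
  qed
  have "(\<integral>x. f x * h ((T ^^ 0) x) \<partial>U) = (\<integral>x. f 0 * h x \<partial>U)"
  proof (rule Bochner_Integration.integral_cong[OF refl])
    fix x assume "x \<in> space U"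
    then have "f x = f 0"
      by (intro const) (simp add: space_restrict_space)
    then show "f x * h ((T ^^ 0) x) = f 0 * h x"
      by simp
  qed
  moreover have "(\<integral>x. f x \<partial>U) = (\<integral>x. f 0 \<partial>U)"
    by (intro Bochner_Integration.integral_cong refl const) (simp add: space_restrict_space)
  ultimately show ?case
    by simp
next
  case (Suc k)
  obtain C where C: "\<And>x. x \<in> {0..<1} \<Longrightarrow> \<bar>f x\<bar> \<le> C"
    using triadic_step_bounded[OF Suc.prems] by blast
  note meas = triadic_step_measurable[OF Suc.prems] h(1)
  have int: "integrable U (\<lambda>x. f x * h ((T ^^ Suc k) x))"
  proof (rule integrable_U_bounded)
    show "(\<lambda>x. f x * h ((T ^^ Suc k) x)) \<in> borel_measurable U"
      using measurable_compose[OF measurable_T_funpow[of "Suc k"] h(1)] meas by simp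
    show "\<bar>f x * h ((T ^^ Suc k) x)\<bar> \<le> C * B" if "x \<in> {0..<1}" for x
      unfolding abs_mult using C[OF that] h(2)[OF T_funpow_range[OF that, of "Suc k"]]
      by (intro mult_mono) auto
  qed
  have branch: "(\<integral>x. f ((x + real d) / 3) * h ((T ^^ Suc k) ((x + real d) / 3)) \<partial>U)
      = (\<integral>x. f ((x + real d) / 3) \<partial>U) * (\<integral>x. h x \<partial>U)" if "d < 3" for d
  proof -
    have "T ((x + real d) / 3) = x" if "x \<in> {0..<1}" for x
    proof -
      have "3 * ((x + real d) / 3) - x = real d"
        by (simp add: field_simps)
      then show ?thesis
        unfolding T_def frac_unique_iff using that by (metis Ints_of_nat atLeastLessThan_iff)
    qed
    then have "(\<integral>x. f ((x + real d) / 3) * h ((T ^^ Suc k) ((x + real d) / 3)) \<partial>U)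
        = (\<integral>x. f ((x + real d) / 3) * h ((T ^^ k) x) \<partial>U)"
      by (intro Bochner_Integration.integral_cong)
         (auto simp: space_restrict_space funpow_swap1)
    also have "\<dots> = (\<integral>x. f ((x + real d) / 3) \<partial>U) * (\<integral>x. h x \<partial>U)"
    proof (rule Suc.IH)
      have shift: "\<lfloor>3 ^ Suc k * ((x + real d) / 3)\<rfloor> = \<lfloor>3 ^ k * x\<rfloor> + int (3 ^ k * d)" for x :: real
      proof -
        have "3 ^ Suc k * ((x + real d) / 3) = 3 ^ k * x + real_of_int (int (3 ^ k * d))"
          by (simp add: field_simps)
        then show ?thesis
          by (simp only: floor_add_int)
      qed
      show "triadic_step k (\<lambda>x. f ((x + real d) / 3))"
        unfolding triadic_step_def
      proof (intro ballI impI)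
        fix x y :: real
        assume "x \<in> {0..<1}" "y \<in> {0..<1}" "same_digits 3 k x y"
        then show "f ((x + real d) / 3) = f ((y + real d) / 3)"
          using \<open>d < 3\<close> shift[of x] shift[of y]
          by (intro triadic_stepD[OF Suc.prems])
             (auto simp: same_digits_def simp del: power_Suc)
      qed
    qed
    finally show ?thesis .
  qed
  have "(\<integral>x. f x * h ((T ^^ Suc k) x) \<partial>U)
      = (\<Sum>d<3. (\<integral>x. f ((x + real d) / 3) \<partial>U) * (\<integral>x. h x \<partial>U)) / 3"
    unfolding integral_thirds[OF int] using branch by simp
  also have "\<dots> = (\<integral>x. f x \<partial>U) * (\<integral>x. h x \<partial>U)"
    using integral_thirds[OF integrable_U_bounded[OF meas(1) C]] by (simp flip: sum_distrib_right)
  finally show ?case .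
qed

text \<open>Invariance of Lebesgue measure under \<open>T\<close> is decorrelation from the constant \<open>1\<close>, which is a step
  function of every level.\<close>

lemma integral_T_funpow:
  fixes h :: "real \<Rightarrow> real"
  assumes "h \<in> borel_measurable U" "\<And>x. x \<in> {0..<1} \<Longrightarrow> \<bar>h x\<bar> \<le> B"
  shows "(\<integral>x. h ((T ^^ n) x) \<partial>U) = (\<integral>x. h x \<partial>U)"
  using decorrelation[of n "\<lambda>_. 1" h B] assms by (simp add: triadic_step_def)

section \<open>Frequencies of triadic digit blocks\<close>

lemma correlation_eq_0:
  assumes f: "triadic_step k f" and mean: "(\<integral>x. f x \<partial>U) = 0" and "i + k \<le> j"
  shows "(\<integral>x. f ((T ^^ i) x) * f ((T ^^ j) x) \<partial>U) = 0"
proof -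
  obtain B where B: "\<And>x. x \<in> {0..<1} \<Longrightarrow> \<bar>f x\<bar> \<le> B"
    using triadic_step_bounded[OF f] by blast
  obtain l where j: "j = l + k + i"
    using le_Suc_ex[OF \<open>i + k \<le> j\<close>] by (auto simp: add_ac)
  note meas = triadic_step_measurable[OF f] measurable_compose[OF measurable_T_funpow triadic_step_measurable[OF f]]
  have "(\<integral>x. f ((T ^^ i) x) * f ((T ^^ j) x) \<partial>U)
      = (\<integral>x. (\<lambda>x. f x * f ((T ^^ (l + k)) x)) ((T ^^ i) x) \<partial>U)"
    by (simp add: j funpow_add)
  also have "\<dots> = (\<integral>x. f x * f ((T ^^ (l + k)) x) \<partial>U)"
  proof (rule integral_T_funpow)
    show "(\<lambda>x. f x * f ((T ^^ (l + k)) x)) \<in> borel_measurable U"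
      using meas by simp
    show "\<bar>f x * f ((T ^^ (l + k)) x)\<bar> \<le> B * B" if "x \<in> {0..<1}" for x
      unfolding abs_mult using B[OF that] B[OF T_funpow_range[OF that, of "l + k"]]
      by (intro mult_mono) auto
  qed
  also have "\<dots> = (\<integral>x. f x * (\<lambda>x. f ((T ^^ l) x)) ((T ^^ k) x) \<partial>U)"
    by (simp add: funpow_add)
  also have "\<dots> = (\<integral>x. f x \<partial>U) * (\<integral>x. f ((T ^^ l) x) \<partial>U)"
    by (rule decorrelation[OF f _ B[OF T_funpow_range]]) (use meas in auto)
  finally show ?thesis
    by (simp add: mean)
qed

text \<open>Adding the summand number \<open>n\<close> to the sum of the earlier ones creates at most \<open>k\<close> cross terms
  that do not vanish, namely those with a summand at a distance of at most \<open>k\<close> steps. The second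
  moment therefore grows by at most \<open>(2 k + 1) B\<^sup>2\<close>.\<close>

lemma second_moment_le:
  assumes f: "triadic_step k f" and mean: "(\<integral>x. f x \<partial>U) = 0"
    and B: "\<And>x. x \<in> {0..<1} \<Longrightarrow> \<bar>f x\<bar> \<le> B"
  shows "(\<integral>x. (\<Sum>i<n. f ((T ^^ i) x))\<^sup>2 \<partial>U) \<le> real n * ((2 * real k + 1) * B\<^sup>2)"
proof (induction n)
  case 0
  show ?case by simp
next
  case (Suc n)
  define S where "S x = (\<Sum>i<n. f ((T ^^ i) x))" for x
  have Bi: "\<bar>f ((T ^^ i) x)\<bar> \<le> B" if "x \<in> {0..<1}" for i x
    by (rule B[OF T_funpow_range[OF that]])
  have [measurable]: "(\<lambda>x. f ((T ^^ i) x)) \<in> borel_measurable U" for i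
    by (rule measurable_compose[OF measurable_T_funpow triadic_step_measurable[OF f]])
  have S_bound: "\<bar>S x\<bar> \<le> real n * B" if "x \<in> {0..<1}" for x
  proof -
    have "\<bar>S x\<bar> \<le> (\<Sum>i<n. B)"
      unfolding S_def by (rule order_trans[OF sum_abs sum_mono]) (rule Bi[OF that])
    then show ?thesis
      by simp
  qed
  have prod_bound: "\<bar>f ((T ^^ i) x) * f ((T ^^ j) x)\<bar> \<le> B\<^sup>2" if "x \<in> {0..<1}" for i j x
    unfolding abs_mult power2_eq_square using Bi[OF that, of i] Bi[OF that, of j]
    by (intro mult_mono) auto
  have int_prod: "integrable U (\<lambda>x. f ((T ^^ i) x) * f ((T ^^ j) x))" for i j
    by (rule integrable_U_bounded[OF _ prod_bound]) measurable
  have int_S: "integrable U (\<lambda>x. (S x)\<^sup>2)"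
  proof (rule integrable_U_bounded)
    show "\<bar>(S x)\<^sup>2\<bar> \<le> (real n * B)\<^sup>2" if "x \<in> {0..<1}" for x
      using power_mono[OF S_bound[OF that], of 2] by simp
  qed (unfold S_def, measurable)
  have cross: "(\<integral>x. S x * f ((T ^^ n) x) \<partial>U) \<le> real k * B\<^sup>2"
  proof -
    have "(\<integral>x. S x * f ((T ^^ n) x) \<partial>U)
        = (\<Sum>i<n. \<integral>x. f ((T ^^ i) x) * f ((T ^^ n) x) \<partial>U)"
      unfolding S_def sum_distrib_right by (rule Bochner_Integration.integral_sum) (rule int_prod)
    also have "\<dots> = (\<Sum>i\<in>{n - k..<n}. \<integral>x. f ((T ^^ i) x) * f ((T ^^ n) x) \<partial>U)"
      by (rule sum.mono_neutral_right) (auto intro: correlation_eq_0[OF f mean])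
    also have "\<dots> \<le> (\<Sum>i\<in>{n - k..<n}. B\<^sup>2)"
    proof (rule sum_mono)
      fix i
      have "\<bar>\<integral>x. f ((T ^^ i) x) * f ((T ^^ n) x) \<partial>U\<bar> \<le> B\<^sup>2"
        by (rule integral_U_bounded[OF _ prod_bound]) measurable
      then show "(\<integral>x. f ((T ^^ i) x) * f ((T ^^ n) x) \<partial>U) \<le> B\<^sup>2"
        by linarith
    qed
    also have "\<dots> \<le> real k * B\<^sup>2"
      by (auto intro!: mult_right_mono)
    finally show ?thesis .
  qed
  have int_cross: "integrable U (\<lambda>x. S x * f ((T ^^ n) x))"
    unfolding S_def sum_distrib_right by (intro Bochner_Integration.integrable_sum int_prod)
  have last: "(\<integral>x. (f ((T ^^ n) x))\<^sup>2 \<partial>U) \<le> B\<^sup>2"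
  proof -
    have "\<bar>\<integral>x. f ((T ^^ n) x) * f ((T ^^ n) x) \<partial>U\<bar> \<le> B\<^sup>2"
      by (rule integral_U_bounded[OF _ prod_bound]) measurable
    then show ?thesis
      by (simp add: power2_eq_square)
  qed
  have "(\<integral>x. (\<Sum>i<Suc n. f ((T ^^ i) x))\<^sup>2 \<partial>U)
      = (\<integral>x. (S x)\<^sup>2 + 2 * (S x * f ((T ^^ n) x)) + (f ((T ^^ n) x))\<^sup>2 \<partial>U)"
    by (simp add: S_def power2_eq_square algebra_simps)
  also have "\<dots> = (\<integral>x. (S x)\<^sup>2 \<partial>U) + 2 * (\<integral>x. S x * f ((T ^^ n) x) \<partial>U)
      + (\<integral>x. (f ((T ^^ n) x))\<^sup>2 \<partial>U)"
    using int_S int_cross int_prod[of n n] by (simp add: power2_eq_square)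
  also have "\<dots> \<le> real n * ((2 * real k + 1) * B\<^sup>2) + 2 * (real k * B\<^sup>2) + B\<^sup>2"
    using Suc.IH cross last by (simp add: S_def)
  finally show ?case
    by (simp add: algebra_simps)
qed

text \<open>The sum of the \<open>g n\<close> has a finite integral, hence is finite almost everywhere, and the terms of
  a convergent series tend to \<open>0\<close>.\<close>

lemma AE_tendsto_0_of_summable_integral:
  fixes g :: "nat \<Rightarrow> 'a \<Rightarrow> real"
  assumes int: "\<And>n. integrable M (g n)" and nonneg: "\<And>n x. 0 \<le> g n x"
    and "summable (\<lambda>n. \<integral>x. g n x \<partial>M)"
  shows "AE x in M. (\<lambda>n. g n x) \<longlonglongrightarrow> 0"
proof -
  have "(\<integral>\<^sup>+x. (\<Sum>n. ennreal (g n x)) \<partial>M) = (\<Sum>n. \<integral>\<^sup>+x. ennreal (g n x) \<partial>M)"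
    using int by (intro nn_integral_suminf) auto
  also have "\<dots> = (\<Sum>n. ennreal (\<integral>x. g n x \<partial>M))"
    using int nonneg by (simp add: nn_integral_eq_integral)
  also have "\<dots> = ennreal (\<Sum>n. \<integral>x. g n x \<partial>M)"
    using assms by (intro suminf_ennreal2) auto
  finally have "AE x in M. (\<Sum>n. ennreal (g n x)) \<noteq> \<infinity>"
    using int by (intro nn_integral_noteq_infinite) auto
  then show ?thesis
  proof eventually_elim
    case (elim x)
    then show ?case
      using summable_suminf_not_top[of "\<lambda>n. g n x"] nonneg by (intro summable_LIMSEQ_zero) auto
  qed
qed

text \<open>For \<open>N\<^sup>2 \<le> n < (N + 1)\<^sup>2\<close> the sums up to \<open>n\<close> and up to \<open>N\<^sup>2\<close> differ by at most \<open>2 N B\<close>, which is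
  negligible against \<open>n\<close>. So the averages along the squares control all averages.\<close>

lemma average_tendsto_0_of_squares:
  fixes a :: "nat \<Rightarrow> real"
  assumes B: "\<And>i. \<bar>a i\<bar> \<le> B"
    and squares: "(\<lambda>N. ((\<Sum>i<(Suc N)\<^sup>2. a i) / real ((Suc N)\<^sup>2))\<^sup>2) \<longlonglongrightarrow> 0"
  shows "(\<lambda>n. (\<Sum>i<n. a i) / real n) \<longlonglongrightarrow> 0"
proof -
  define s where "s n = (\<Sum>i<n. a i)" for n
  have "filterlim floor_sqrt at_top sequentially"
    unfolding filterlim_at_top
    by (metis eventually_sequentially le_floor_sqrtI le_trans)
  then have r: "filterlim floor_sqrt sequentially sequentially" .
  have "(\<lambda>N. \<bar>s ((Suc N)\<^sup>2) / real ((Suc N)\<^sup>2)\<bar>) \<longlonglongrightarrow> 0"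
    using tendsto_real_sqrt[OF squares] by (simp add: s_def)
  then have "(\<lambda>N. \<bar>s (N\<^sup>2) / real (N\<^sup>2)\<bar>) \<longlonglongrightarrow> 0"
    by (rule LIMSEQ_imp_Suc)
  moreover have "(\<lambda>N. 2 * B / real N) \<longlonglongrightarrow> 0"
    by (rule lim_const_over_n)
  ultimately have "(\<lambda>N. \<bar>s (N\<^sup>2) / real (N\<^sup>2)\<bar> + 2 * B / real N) \<longlonglongrightarrow> 0 + 0"
    by (rule tendsto_add)
  then have lim: "(\<lambda>n. \<bar>s ((floor_sqrt n)\<^sup>2) / real ((floor_sqrt n)\<^sup>2)\<bar> + 2 * B / real (floor_sqrt n))
      \<longlonglongrightarrow> 0"
    using filterlim_compose[OF _ r] by simp
  have bound: "\<bar>s n / real n\<bar>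
      \<le> \<bar>s ((floor_sqrt n)\<^sup>2) / real ((floor_sqrt n)\<^sup>2)\<bar> + 2 * B / real (floor_sqrt n)"
    if "n > 0" for n
  proof -
    define N where "N = floor_sqrt n"
    have "N > 0" "N\<^sup>2 \<le> n" "n \<le> N\<^sup>2 + 2 * N"
      using that floor_sqrt_power2_le[of n] Suc_floor_sqrt_power2_gt[of n]
      by (simp_all add: N_def power2_eq_square del: floor_sqrt_power2_le)
    have "B \<ge> 0"
      using B[of 0] by linarith
    have "{..<n} = {..<N\<^sup>2} \<union> {N\<^sup>2..<n}"
      using \<open>N\<^sup>2 \<le> n\<close> by auto
    then have "s n = s (N\<^sup>2) + (\<Sum>i\<in>{N\<^sup>2..<n}. a i)"
      unfolding s_def by (simp add: sum.union_disjoint ivl_disj_int)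
    moreover have "\<bar>\<Sum>i\<in>{N\<^sup>2..<n}. a i\<bar> \<le> (\<Sum>i\<in>{N\<^sup>2..<n}. B)"
      by (rule order_trans[OF sum_abs sum_mono]) (rule B)
    moreover have "(\<Sum>i\<in>{N\<^sup>2..<n}. B) \<le> real (2 * N) * B"
      using \<open>B \<ge> 0\<close> \<open>n \<le> N\<^sup>2 + 2 * N\<close> by (simp del: of_nat_mult) (intro mult_right_mono, linarith, simp)
    ultimately have "\<bar>s n\<bar> \<le> \<bar>s (N\<^sup>2)\<bar> + 2 * real N * B"
      by simp
    then have "\<bar>s n\<bar> / real n \<le> (\<bar>s (N\<^sup>2)\<bar> + 2 * real N * B) / real (N\<^sup>2)"
      using \<open>N > 0\<close> \<open>N\<^sup>2 \<le> n\<close> \<open>B \<ge> 0\<close> by (intro frac_le) (auto simp del: of_nat_power)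
    also have "\<dots> = \<bar>s (N\<^sup>2)\<bar> / real (N\<^sup>2) + 2 * B / real N"
      using \<open>N > 0\<close> by (simp add: field_simps power2_eq_square)
    finally show ?thesis
      by (simp add: N_def)
  qed
  show ?thesis
    unfolding s_def[symmetric]
    by (rule Lim_null_comparison[OF _ lim])
       (use bound in \<open>auto intro: eventually_mono[OF eventually_gt_at_top[of 0]]\<close>)
qed

text \<open>The strong law of large numbers for functions of finitely many digits. The second moment of the
  average of \<open>n\<close> terms is of order \<open>1/n\<close>, which is summable along the squares \<open>n = N\<^sup>2\<close>.\<close>

lemma triadic_step_average:
  assumes f: "triadic_step k f"
  shows "AE x in U. (\<lambda>n. (\<Sum>i<n. f ((T ^^ i) x)) / real n) \<longlonglongrightarrow> (\<integral>x. f x \<partial>U)"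
proof -
  define m where "m = (\<integral>x. f x \<partial>U)"
  define g where "g x = f x - m" for x
  have g: "triadic_step k g"
    using triadic_stepD[OF f] unfolding triadic_step_def g_def by metis
  obtain B where B: "\<And>x. x \<in> {0..<1} \<Longrightarrow> \<bar>g x\<bar> \<le> B"
    using triadic_step_bounded[OF g] by blast
  obtain B' where B': "\<And>x. x \<in> {0..<1} \<Longrightarrow> \<bar>f x\<bar> \<le> B'"
    using triadic_step_bounded[OF f] by blast
  have mean: "(\<integral>x. g x \<partial>U) = 0"
    using integrable_U_bounded[OF triadic_step_measurable[OF f] B']
    by (simp add: g_def m_def)
  define q where "q N x = ((\<Sum>i<(Suc N)\<^sup>2. g ((T ^^ i) x)) / real ((Suc N)\<^sup>2))\<^sup>2" for N x
  have Bi: "\<bar>g ((T ^^ i) x)\<bar> \<le> B" if "x \<in> {0..<1}" for i x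
    by (rule B[OF T_funpow_range[OF that]])
  have [measurable]: "(\<lambda>x. g ((T ^^ i) x)) \<in> borel_measurable U" for i
    by (rule measurable_compose[OF measurable_T_funpow triadic_step_measurable[OF g]])
  have "AE x in U. (\<lambda>N. q N x) \<longlonglongrightarrow> 0"
  proof (rule AE_tendsto_0_of_summable_integral)
    show "0 \<le> q N x" for N x
      by (simp add: q_def)
    show "integrable U (q N)" for N
    proof (rule integrable_U_bounded)
      show "q N \<in> borel_measurable U"
        unfolding q_def by measurable
      fix x :: real assume "x \<in> {0..<1}"
      then have "\<bar>\<Sum>i<(Suc N)\<^sup>2. g ((T ^^ i) x)\<bar> \<le> (\<Sum>i<(Suc N)\<^sup>2. B)"
        by (intro order_trans[OF sum_abs sum_mono] Bi)
      then have "\<bar>(\<Sum>i<(Suc N)\<^sup>2. g ((T ^^ i) x)) / real ((Suc N)\<^sup>2)\<bar> \<le> B"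
        by (simp add: field_simps del: of_nat_Suc of_nat_power)
      from power_mono[OF this, of 2] show "\<bar>q N x\<bar> \<le> B\<^sup>2"
        unfolding q_def by (metis abs_ge_zero abs_of_nonneg power2_abs zero_le_power2)
    qed
    have bound: "(\<integral>x. q N x \<partial>U) \<le> (2 * real k + 1) * B\<^sup>2 * (1 / real (Suc N) ^ 2)" for N
    proof -
      have "(\<integral>x. q N x \<partial>U) = (\<integral>x. (\<Sum>i<(Suc N)\<^sup>2. g ((T ^^ i) x))\<^sup>2 \<partial>U) / (real ((Suc N)\<^sup>2))\<^sup>2"
        unfolding q_def power_divide by simp
      also have "\<dots> \<le> (real ((Suc N)\<^sup>2) * ((2 * real k + 1) * B\<^sup>2)) / (real ((Suc N)\<^sup>2))\<^sup>2"
        by (intro divide_right_mono second_moment_le[OF g mean B]) auto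
      also have "\<dots> = (2 * real k + 1) * B\<^sup>2 * (1 / real ((Suc N)\<^sup>2))"
      proof -
        have "M * C / M\<^sup>2 = C * (1 / M)" for M C :: real
          by (cases "M = 0") (simp_all add: power2_eq_square)
        then show ?thesis .
      qed
      finally show ?thesis
        by (simp only: of_nat_power)
    qed
    have "summable (\<lambda>N. (2 * real k + 1) * B\<^sup>2 * (1 / real (Suc N) ^ 2))"
      using inverse_power_summable[of 2, where 'a = real, THEN summable_Suc_iff[THEN iffD2]]
      by (intro summable_mult) (simp add: inverse_eq_divide)
    then show "summable (\<lambda>N. \<integral>x. q N x \<partial>U)"
    proof (rule summable_comparison_test'[where N = 0])
      fix N
      have "0 \<le> (\<integral>x. q N x \<partial>U)"
        by (rule Bochner_Integration.integral_nonneg) (simp add: q_def)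
      then show "norm (\<integral>x. q N x \<partial>U) \<le> (2 * real k + 1) * B\<^sup>2 * (1 / real (Suc N) ^ 2)"
        using bound[of N] by (simp only: real_norm_def abs_of_nonneg)
    qed
  qed
  moreover have "AE x in U. x \<in> {0..<1}"
    by (rule AE_I2) (simp add: space_restrict_space)
  ultimately show ?thesis
  proof eventually_elim
    case (elim x)
    have "(\<lambda>n. (\<Sum>i<n. g ((T ^^ i) x)) / real n) \<longlonglongrightarrow> 0"
      using average_tendsto_0_of_squares[of "\<lambda>i. g ((T ^^ i) x)" B] Bi elim by (simp add: q_def)
    then have "(\<lambda>n. (\<Sum>i<n. g ((T ^^ i) x)) / real n + m) \<longlonglongrightarrow> 0 + m"
      by (intro tendsto_add tendsto_const)
    moreover have "\<forall>\<^sub>F n in sequentially. (\<Sum>i<n. g ((T ^^ i) x)) / real n + m = (\<Sum>i<n. f ((T ^^ i) x)) / real n"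
      using eventually_gt_at_top[of 0]
      by eventually_elim (simp add: g_def sum_subtractf field_simps)
    ultimately show ?case
      unfolding m_def[symmetric] by (simp add: tendsto_cong)
  qed
qed

section \<open>Forgetting the initial point\<close>

text \<open>If \<open>h\<close> is the number of pushes minus the number of pops in the first \<open>m\<close> steps, then this is
  \<open>(3/4)\<^sup>h\<close>. The base \<open>r = 3/4\<close> is chosen so that a step multiplies the weight by less than \<open>1\<close> on
  average, \<open>2/3 r + 1/3 r\<^sup>-\<^sup>1 < 1\<close>, which holds for \<open>1/2 < r < 1\<close>, and so that \<open>r\<close> is at least the rate
  \<open>2/3\<close> at which a push contracts \<open>y\<close>.\<close>

definition weight :: "nat \<Rightarrow> real \<Rightarrow> real" where
  "weight m x = (\<Prod>i<m. if (T ^^ i) x < 2/3 then 3/4 else 4/3)"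

lemma weight_0: "weight 0 x = 1"
  by (simp add: weight_def)

lemma weight_Suc: "weight (Suc m) x = (if (T ^^ m) x < 2/3 then 3/4 else 4/3) * weight m x"
  by (simp add: weight_def)

lemma weight_Suc_shift: "weight (Suc m) x = (if x < 2/3 then 3/4 else 4/3) * weight m (T x)"
  unfolding weight_def prod.lessThan_Suc_shift by (simp add: funpow_swap1)

lemma same_digits_T:
  assumes "same_digits 3 (Suc k) x y"
  shows "\<lfloor>3 * x\<rfloor> = \<lfloor>3 * y\<rfloor>" "same_digits 3 k (T x) (T y)"
  using same_digits_Suc[OF _ assms] by (simp_all add: T_def)

lemma less_thirds_iff_floor:
  fixes x :: real
  shows "x < 1/3 \<longleftrightarrow> \<lfloor>3 * x\<rfloor> < 1" "x < 2/3 \<longleftrightarrow> \<lfloor>3 * x\<rfloor> < 2"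
  by linarith+

lemma triadic_step_weight: "triadic_step m (weight m)"
proof (induction m)
  case 0
  show ?case by (simp add: triadic_step_def weight_0)
next
  case (Suc m)
  show ?case
    unfolding triadic_step_def
  proof (intro ballI impI)
    fix x y :: real
    assume "same_digits 3 (Suc m) x y"
    note same = same_digits_T[OF this]
    have "weight m (T x) = weight m (T y)"
      by (rule triadic_stepD[OF Suc.IH same(2) T_range T_range])
    then show "weight (Suc m) x = weight (Suc m) y"
      unfolding weight_Suc_shift less_thirds_iff_floor same(1) by simp
  qed
qed

text \<open>The factors of the weight are functions of distinct digits, hence independent, and each has mean
  \<open>(3/4 + 3/4 + 4/3) / 3 = 17/18\<close>.\<close>

lemma integral_weight: "(\<integral>x. weight m x \<partial>U) = (17/18) ^ m"
proof (induction m)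
  case 0
  show ?case by (simp add: weight_0)
next
  case (Suc m)
  define v :: "real \<Rightarrow> real" where "v x = (if x < 2/3 then 3/4 else 4/3)" for x
  have v: "triadic_step 1 v"
    unfolding triadic_step_def
  proof (intro ballI impI)
    fix x y :: real
    assume "same_digits 3 1 x y"
    then show "v x = v y"
      using same_digits_T(1)[of 0 x y] unfolding v_def less_thirds_iff_floor by simp
  qed
  obtain C where C: "\<And>x. x \<in> {0..<1} \<Longrightarrow> \<bar>v x\<bar> \<le> C"
    using triadic_step_bounded[OF v] by blast
  obtain B where B: "\<And>x. x \<in> {0..<1} \<Longrightarrow> \<bar>weight m x\<bar> \<le> B"
    using triadic_step_bounded[OF triadic_step_weight] by blast
  have branch: "(\<integral>x. v ((x + real d) / 3) \<partial>U) = (if d < 2 then 3/4 else 4/3)" if "d < 3" for d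
  proof -
    have "(\<integral>x. v ((x + real d) / 3) \<partial>U) = (\<integral>x. (if d < 2 then 3/4 else 4/3) \<partial>U)"
    proof (rule Bochner_Integration.integral_cong[OF refl])
      fix x assume "x \<in> space U"
      then have "0 \<le> x" "x < 1"
        by (simp_all add: space_restrict_space)
      moreover have "d = 0 \<or> d = 1 \<or> d = 2"
        using that by auto
      ultimately show "v ((x + real d) / 3) = (if d < 2 then 3/4 else 4/3)"
        by (auto simp: v_def)
    qed
    then show ?thesis
      by simp
  qed
  have "(\<integral>x. v x \<partial>U) = 17/18"
    using integral_thirds[OF integrable_U_bounded[OF triadic_step_measurable[OF v] C]]
    by (simp add: branch eval_nat_numeral)
  moreover have "(\<integral>x. weight (Suc m) x \<partial>U) = (\<integral>x. v x * weight m ((T ^^ 1) x) \<partial>U)"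
    by (simp add: weight_Suc_shift v_def)
  moreover have "\<dots> = (\<integral>x. v x \<partial>U) * (\<integral>x. weight m x \<partial>U)"
    by (rule decorrelation[OF v triadic_step_measurable[OF triadic_step_weight] B])
  ultimately show ?case
    using Suc.IH by simp
qed

text \<open>The points whose trajectories follow the stack picture. The value \<open>x = 1\<close> is left out because \<open>T\<close>
  and \<open>\<tau>\<close> differ there, and \<open>z = 1\<close> because the map misreads its expansion: as
  \<open>0.111\<dots>\<close> it becomes \<open>0.0111\<dots>\<close> when \<open>0\<close> is pushed, but the map reads the result \<open>1/2\<close> as
  \<open>0.1000\<dots>\<close>, so that a following pop does not return \<open>1\<close>.\<close>

definition generic_cube :: "(real \<times> real \<times> real) set" where
  "generic_cube = {0..<1} \<times> {0..1} \<times> {0..<1}"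

lemma generic_cube_subset: "generic_cube \<subseteq> unit_cube"
  by (auto simp: generic_cube_def unit_cube_def)

lemma hc3_generic:
  assumes "(x, y, z) \<in> generic_cube"
  shows "hc3 (x, y, z) =
    (T x,
     if x < 2/3 then 2/3 * y else if z < 1/2 then 2/3 + 1/6 * y else 5/6 + 1/6 * y,
     if x < 1/3 then 1/2 * z else if x < 2/3 then 1/2 + 1/2 * z else frac (2 * z))"
proof -
  have "frac (2 * z) = (if z < 1/2 then 2 * z else - 1 + 2 * z)"
    using assms by (auto simp: frac_unique_iff generic_cube_def)
  then show ?thesis
    using assms
    by (simp add: hc3_def region_A_def region_B_def region_C_def region_D_def generic_cube_def
        tau_def T_def)
qed

lemma hc3_generic_cube: "p \<in> generic_cube \<Longrightarrow> hc3 p \<in> generic_cube"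
proof -
  assume p: "p \<in> generic_cube"
  obtain x y z where xyz: "p = (x, y, z)"
    by (cases p)
  show ?thesis
    using p unfolding xyz hc3_generic[OF p[unfolded xyz]]
    by (auto simp: generic_cube_def T_def frac_lt_1)
qed

lemma hc3_funpow_generic_cube: "p \<in> generic_cube \<Longrightarrow> (hc3 ^^ n) p \<in> generic_cube"
  by (induction n) (auto intro: hc3_generic_cube)

lemma fst_hc3_funpow: "p \<in> generic_cube \<Longrightarrow> fst ((hc3 ^^ n) p) = (T ^^ n) (fst p)"
proof (induction n)
  case (Suc n)
  obtain x y z where xyz: "(hc3 ^^ n) p = (x, y, z)"
    by (cases "(hc3 ^^ n) p")
  then have "(x, y, z) \<in> generic_cube"
    using hc3_funpow_generic_cube[OF Suc.prems, of n] by simp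
  then show ?case
    using Suc xyz by (simp add: hc3_generic)
qed simp

text \<open>Here \<open>d\<close> is the number of digits on top of the stack that are known to agree in the two points, and
  \<open>w\<close> is a common bound for the distance of the \<open>y\<close>-coordinates and for \<open>(3/4)\<^sup>d\<close>. The second bound is
  what carries the first one through a pop with \<open>d = 0\<close>.\<close>

definition coupled ::
  "nat \<Rightarrow> nat \<Rightarrow> real \<Rightarrow> real \<times> real \<times> real \<Rightarrow> real \<times> real \<times> real \<Rightarrow> bool" where
  "coupled j d w = (\<lambda>(x, y, z) (x', y', z').
     same_digits 3 j x x' \<and> same_digits 2 d z z' \<and> \<bar>y - y'\<bar> \<le> w \<and> (3/4) ^ d \<le> w)"

text \<open>A push adds a common digit and contracts \<open>y\<close> by \<open>2/3 \<le> 3/4\<close>. A pop with \<open>d > 0\<close> deletes the same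
  digit from both points, so the same contraction by \<open>1/6\<close> acts on both values of \<open>y\<close>. A pop with
  \<open>d = 0\<close> may send one point to \<open>B\<close> and the other to \<open>C\<close>, which destroys all knowledge of \<open>y\<close>; but
  then \<open>w \<ge> (3/4)\<^sup>0 = 1\<close>, and the trivial bound \<open>1\<close> for the distance is good enough.\<close>

lemma coupled_hc3:
  assumes p: "p \<in> generic_cube" and p': "p' \<in> generic_cube" and "coupled (Suc j) d w p p'"
  shows "\<exists>d'. coupled j d' ((if fst p < 2/3 then 3/4 else 4/3) * w) (hc3 p) (hc3 p')"
proof -
  obtain x y z where xyz: "p = (x, y, z)"
    by (cases p)
  obtain x' y' z' where xyz': "p' = (x', y', z')"
    by (cases p')
  have same_x: "same_digits 3 (Suc j) x x'" and same_z: "same_digits 2 d z z'"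
    and y: "\<bar>y - y'\<bar> \<le> w" and d: "(3/4) ^ d \<le> w"
    using assms(3) by (auto simp: coupled_def xyz xyz')
  have w: "0 < w"
    using less_le_trans[OF _ d] by simp
  note T_same = same_digits_T[OF same_x]
  note branch = less_thirds_iff_floor[of x, unfolded T_same(1), folded less_thirds_iff_floor]
  note unfold_hc3 = hc3_generic[OF p[unfolded xyz]] hc3_generic[OF p'[unfolded xyz']]
  have in_y: "y \<in> {0..1}" "y' \<in> {0..1}" and in_z: "z \<in> {0..<1}" "z' \<in> {0..<1}"
    using p p' by (auto simp: xyz xyz' generic_cube_def)
  have y_contract: "\<bar>2/3 * y - 2/3 * y'\<bar> \<le> 3/4 * w"
    using y w by linarith
  consider "x < 1/3" | "1/3 \<le> x" "x < 2/3" | "2/3 \<le> x"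
    by linarith
  then show ?thesis
  proof cases
    case 1
    have "2 ^ Suc d * (1/2 * u) = 2 ^ d * u" for u :: real
      by simp
    then have "same_digits 2 (Suc d) (1/2 * z) (1/2 * z')"
      using same_z by (simp add: same_digits_def)
    then have "coupled j (Suc d) (3/4 * w) (hc3 p) (hc3 p')"
      using 1 branch T_same y_contract d unfolding xyz xyz' unfold_hc3 by (simp add: coupled_def)
    then show ?thesis
      using 1 by (auto simp: xyz)
  next
    case 2
    have "\<lfloor>2 ^ Suc d * (1/2 + 1/2 * u)\<rfloor> = \<lfloor>2 ^ d * u\<rfloor> + 2 ^ d" for u :: real
    proof -
      have "2 ^ Suc d * (1/2 + 1/2 * u) = 2 ^ d * u + real_of_int (2 ^ d)"
        by (simp add: algebra_simps)
      then show ?thesis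
        by (simp only: floor_add_int)
    qed
    then have "same_digits 2 (Suc d) (1/2 + 1/2 * z) (1/2 + 1/2 * z')"
      using same_z by (simp add: same_digits_def del: power_Suc)
    then have "coupled j (Suc d) (3/4 * w) (hc3 p) (hc3 p')"
      using 2 branch T_same y_contract d unfolding xyz xyz' unfold_hc3 by (simp add: coupled_def)
    then show ?thesis
      using 2 by (auto simp: xyz)
  next
    case 3
    show ?thesis
    proof (cases d)
      case 0
      then have "1 \<le> 4/3 * w"
        using d by simp
      moreover have "same_digits 2 0 (frac (2 * z)) (frac (2 * z'))"
        by (simp add: same_digits_def)
      moreover have "\<bar>(if z < 1/2 then 2/3 + 1/6 * y else 5/6 + 1/6 * y)
          - (if z' < 1/2 then 2/3 + 1/6 * y' else 5/6 + 1/6 * y')\<bar> \<le> 1"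
        using in_y by (auto simp: abs_le_iff)
      ultimately have "coupled j 0 (4/3 * w) (hc3 p) (hc3 p')"
        using 3 branch T_same unfolding xyz xyz' unfold_hc3 by (simp add: coupled_def)
      then show ?thesis
        using 3 by (auto simp: xyz)
    next
      case (Suc e)
      have "\<lfloor>2 * z\<rfloor> = \<lfloor>2 * z'\<rfloor>" and same: "same_digits 2 e (frac (2 * z)) (frac (2 * z'))"
        using same_digits_Suc[of 2 e z z'] same_z by (simp_all add: Suc)
      moreover have "u < 1/2 \<longleftrightarrow> \<lfloor>2 * u\<rfloor> < 1" for u :: real
        by linarith
      ultimately have half: "z < 1/2 \<longleftrightarrow> z' < 1/2"
        by metis
      have "(3/4) ^ e \<le> 4/3 * w"
        using d by (simp add: Suc)
      moreover have "\<bar>1/6 * y - 1/6 * y'\<bar> \<le> 4/3 * w"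
        using y w by linarith
      ultimately have "coupled j e (4/3 * w) (hc3 p) (hc3 p')"
        using 3 branch T_same same half unfolding xyz xyz' unfold_hc3 by (simp add: coupled_def)
      then show ?thesis
        using 3 by (auto simp: xyz)
    qed
  qed
qed

text \<open>Any two points are coupled with \<open>d = 0\<close> and \<open>w = 1\<close> at the start, so only the digits of \<open>x\<close> have
  to agree.\<close>

lemma coupled_hc3_funpow:
  assumes p: "p \<in> generic_cube" and p': "p' \<in> generic_cube"
    and same: "same_digits 3 (m + j) (fst p) (fst p')"
  shows "\<exists>d. coupled j d (weight m (fst p)) ((hc3 ^^ m) p) ((hc3 ^^ m) p')"
  using same
proof (induction m arbitrary: j)
  case 0
  have "same_digits 2 0 (snd (snd p)) (snd (snd p'))" "\<bar>fst (snd p) - fst (snd p')\<bar> \<le> 1"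
    using p p' by (auto simp: generic_cube_def intro!: same_digits_0)
  then have "coupled j 0 1 p p'"
    using 0 by (simp add: coupled_def split_beta)
  then show ?case
    by (auto simp: weight_0)
next
  case (Suc m)
  then obtain d where "coupled (Suc j) d (weight m (fst p)) ((hc3 ^^ m) p) ((hc3 ^^ m) p')"
    by fastforce
  from coupled_hc3[OF hc3_funpow_generic_cube[OF p] hc3_funpow_generic_cube[OF p'] this]
  show ?case
    by (simp add: weight_Suc fst_hc3_funpow[OF p])
qed

lemma dist_hc3_funpow_le:
  assumes p: "p \<in> generic_cube" and p': "p' \<in> generic_cube"
    and same: "same_digits 3 (m + j) (fst p) (fst p')"
  shows "dist ((hc3 ^^ m) p) ((hc3 ^^ m) p') \<le> (1/3) ^ j + 2 * weight m (fst p)"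
proof -
  obtain d where d: "coupled j d (weight m (fst p)) ((hc3 ^^ m) p) ((hc3 ^^ m) p')"
    using coupled_hc3_funpow[OF assms] by blast
  obtain x y z where xyz: "(hc3 ^^ m) p = (x, y, z)"
    by (cases "(hc3 ^^ m) p")
  obtain x' y' z' where xyz': "(hc3 ^^ m) p' = (x', y', z')"
    by (cases "(hc3 ^^ m) p'")
  have "\<bar>x - x'\<bar> \<le> (1/3) ^ j" "\<bar>y - y'\<bar> \<le> weight m (fst p)"
    using d same_digits_dist[of 3 j x x'] by (auto simp: coupled_def xyz xyz')
  moreover have "\<bar>z - z'\<bar> \<le> (1/2) ^ d"
    using d same_digits_dist[of 2 d z z'] by (auto simp: coupled_def xyz xyz')
  moreover have "(1/2) ^ d \<le> (3/4 :: real) ^ d"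
    by (rule power_mono) auto
  moreover have "(3/4) ^ d \<le> weight m (fst p)"
    using d by (auto simp: coupled_def xyz xyz')
  moreover have "dist (x, y, z) (x', y', z') \<le> \<bar>x - x'\<bar> + (\<bar>y - y'\<bar> + \<bar>z - z'\<bar>)"
    unfolding dist_Pair_Pair dist_real_def
    by (rule order_trans[OF sqrt_sum_squares_le_sum]) (auto intro: sqrt_sum_squares_le_sum_abs order_trans[OF sqrt_sum_squares_le_sum])
  ultimately show ?thesis
    unfolding xyz xyz' by linarith
qed

section \<open>Trajectory averages\<close>

text \<open>Uniform continuity covers points at distance less than some \<open>\<delta>\<close>; for the others, with \<open>B\<close> a bound
  of \<open>\<bar>\<phi>\<bar>\<close>, the trivial estimate \<open>2 B\<close> is at most \<open>2 B / \<delta>\<close> times the distance. A bound that is affine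
  in the distance can be averaged along a trajectory.\<close>

lemma uniformly_continuous_affine_bound:
  fixes \<phi> :: "'a::metric_space \<Rightarrow> real"
  assumes "compact M" "continuous_on M \<phi>" "\<epsilon> > 0"
  shows "\<exists>C\<ge>0. \<forall>p\<in>M. \<forall>q\<in>M. \<bar>\<phi> p - \<phi> q\<bar> \<le> \<epsilon> + C * dist p q"
proof -
  obtain B where B: "B > 0" "\<And>p. p \<in> M \<Longrightarrow> \<bar>\<phi> p\<bar> \<le> B"
    using compact_imp_bounded[OF compact_continuous_image[OF assms(2,1)]]
    unfolding bounded_pos by auto
  obtain \<delta> where \<delta>: "\<delta> > 0" "\<And>p q. p \<in> M \<Longrightarrow> q \<in> M \<Longrightarrow> dist q p < \<delta> \<Longrightarrow> dist (\<phi> q) (\<phi> p) < \<epsilon>"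
    using compact_uniformly_continuous[OF assms(2,1)] assms(3)
    unfolding uniformly_continuous_on_def by metis
  have "\<bar>\<phi> p - \<phi> q\<bar> \<le> \<epsilon> + 2 * B / \<delta> * dist p q" if "p \<in> M" "q \<in> M" for p q
  proof (cases "dist p q < \<delta>")
    case True
    then have "\<bar>\<phi> p - \<phi> q\<bar> < \<epsilon>"
      using \<delta>(2)[OF that(2,1)] by (simp add: dist_real_def)
    moreover have "0 \<le> 2 * B / \<delta> * dist p q"
      using B \<delta> by simp
    ultimately show ?thesis
      by linarith
  next
    case False
    then have "2 * B \<le> 2 * B / \<delta> * dist p q"
      using B \<delta> by (simp add: field_simps)
    then show ?thesis
      using B(2)[OF that(1)] B(2)[OF that(2)] assms(3) by linarith
  qed
  then show ?thesis
    using B \<delta> by (intro exI[of _ "2 * B / \<delta>"]) auto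
qed

lemma sum_shift_bound:
  fixes a :: "nat \<Rightarrow> real"
  assumes B: "\<And>i. \<bar>a i\<bar> \<le> B"
  shows "\<bar>(\<Sum>i<n. a i) - (\<Sum>i<n. a (m + i))\<bar> \<le> 2 * real m * B"
proof (induction m)
  case (Suc m)
  have "(\<Sum>i<n. a (Suc m + i)) + a m = (\<Sum>i<n. a (m + i)) + a (m + n)"
    using sum.lessThan_Suc_shift[of "\<lambda>i. a (m + i)" n] by simp
  then show ?case
    using Suc.IH B[of m] B[of "m + n"] by (simp add: algebra_simps)
qed simp

lemma compact_unit_cube: "compact unit_cube"
  by (simp add: unit_cube_def compact_Times)

text \<open>The trajectory is read with a delay of \<open>m\<close> steps, which changes the sums by a bounded amount only.
  At time \<open>m + i\<close> it has forgotten its position at time \<open>i\<close> except for the digits of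
  \<open>T\<^sup>i x\<close>, so \<open>\<phi>\<close> may be replaced by the step function \<open>f\<close> at \<open>T\<^sup>i x\<close>. Four errors of at most \<open>\<epsilon>/5\<close>
  occur: one from uniform continuity, one from the coupling, one from the delay, and one from the
  convergence of the averages of \<open>f\<close>.\<close>

lemma average_eventually_close:
  assumes \<phi>: "continuous_on unit_cube \<phi>" and "\<epsilon> > 0"
  shows "\<exists>A. AE x in U. \<forall>p\<in>generic_cube. fst p = x \<longrightarrow>
    (\<forall>\<^sub>F n in sequentially. \<bar>1 / real n * (\<Sum>i<n. \<phi> ((hc3 ^^ i) p)) - A\<bar> < \<epsilon>)"
proof -
  obtain C where "C \<ge> 0"
    and C: "\<And>p q. p \<in> unit_cube \<Longrightarrow> q \<in> unit_cube \<Longrightarrow> \<bar>\<phi> p - \<phi> q\<bar> \<le> \<epsilon>/5 + C * dist p q"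
    using uniformly_continuous_affine_bound[OF compact_unit_cube \<phi>, of "\<epsilon>/5"] \<open>\<epsilon> > 0\<close> by auto
  obtain B where B: "\<And>p. p \<in> unit_cube \<Longrightarrow> \<bar>\<phi> p\<bar> \<le> B"
    using compact_imp_bounded[OF compact_continuous_image[OF \<phi> compact_unit_cube]]
    unfolding bounded_iff by auto
  have "(\<lambda>m. C * ((1/3) ^ m + 2 * (17/18) ^ m)) \<longlonglongrightarrow> C * (0 + 2 * 0)"
    by (intro tendsto_intros LIMSEQ_realpow_zero) auto
  then have "\<forall>\<^sub>F m in sequentially. C * ((1/3) ^ m + 2 * (17/18) ^ m) < \<epsilon>/5"
    using \<open>\<epsilon> > 0\<close> by (intro order_tendstoD) auto
  then obtain m where m: "C * ((1/3) ^ m + 2 * (17/18) ^ m) < \<epsilon>/5"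
    by (auto simp: eventually_sequentially)
  \<comment> \<open>The first \<open>m\<close> of the \<open>m + m\<close> digits steer the \<open>m\<close> steps; the other \<open>m\<close> locate \<open>T\<^sup>m x\<close> up to \<open>3\<^sup>-\<^sup>m\<close>.\<close>
  define rnd :: "real \<Rightarrow> real \<times> real \<times> real"
    where "rnd x = (real_of_int \<lfloor>3 ^ (m + m) * x\<rfloor> / 3 ^ (m + m), 0, 0)" for x
  define f where "f x = \<phi> ((hc3 ^^ m) (rnd x))" for x
  have f: "triadic_step (m + m) f"
    by (simp add: triadic_step_def f_def rnd_def same_digits_def)
  have rnd: "rnd x \<in> generic_cube" "same_digits 3 (m + m) x (fst (rnd x))" if "x \<in> {0..<1}" for x
  proof -
    have "real_of_int \<lfloor>3 ^ (m + m) * x\<rfloor> < 3 ^ (m + m)"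
      using that by (intro le_less_trans[OF of_int_floor_le]) simp
    then show "rnd x \<in> generic_cube"
      using that by (simp add: rnd_def generic_cube_def field_simps)
    show "same_digits 3 (m + m) x (fst (rnd x))"
      by (simp add: rnd_def same_digits_def)
  qed
  define A where "A = (\<integral>x. f x \<partial>U)"
  have step: "\<bar>\<phi> ((hc3 ^^ m) p) - f (fst p)\<bar> \<le> \<epsilon>/5 + C * ((1/3) ^ m + 2 * weight m (fst p))"
    if "p \<in> generic_cube" for p
  proof -
    have fst_p: "fst p \<in> {0..<1}"
      using that by (auto simp: generic_cube_def)
    note rnd = rnd[OF fst_p]
    have "\<bar>\<phi> ((hc3 ^^ m) p) - f (fst p)\<bar>
        \<le> \<epsilon>/5 + C * dist ((hc3 ^^ m) p) ((hc3 ^^ m) (rnd (fst p)))"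
      unfolding f_def
      by (intro C subsetD[OF generic_cube_subset] hc3_funpow_generic_cube that rnd)
    also have "\<dots> \<le> \<epsilon>/5 + C * ((1/3) ^ m + 2 * weight m (fst p))"
      by (intro add_left_mono mult_left_mono dist_hc3_funpow_le that rnd \<open>C \<ge> 0\<close>)
    finally show ?thesis .
  qed
  have "AE x in U. (\<lambda>n. (\<Sum>i<n. f ((T ^^ i) x)) / real n) \<longlonglongrightarrow> A"
    unfolding A_def by (rule triadic_step_average[OF f])
  moreover have "AE x in U. (\<lambda>n. (\<Sum>i<n. weight m ((T ^^ i) x)) / real n) \<longlonglongrightarrow> (17/18) ^ m"
    using triadic_step_average[OF triadic_step_weight[of m]] by (simp only: integral_weight)
  ultimately have "AE x in U. \<forall>p\<in>generic_cube. fst p = x \<longrightarrow>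
    (\<forall>\<^sub>F n in sequentially. \<bar>1 / real n * (\<Sum>i<n. \<phi> ((hc3 ^^ i) p)) - A\<bar> < \<epsilon>)"
  proof eventually_elim
    case (elim x)
    define a where "a n = (\<Sum>i<n. f ((T ^^ i) x)) / real n" for n
    define b where "b n = (\<Sum>i<n. weight m ((T ^^ i) x)) / real n" for n
    have "\<forall>\<^sub>F n in sequentially. \<bar>a n - A\<bar> < \<epsilon>/5"
      using tendstoD[OF elim(1), of "\<epsilon>/5"] \<open>\<epsilon> > 0\<close> by (simp add: a_def dist_real_def)
    moreover have "\<forall>\<^sub>F n in sequentially. C * ((1/3) ^ m + 2 * b n) < \<epsilon>/5"
    proof -
      have "(\<lambda>n. C * ((1/3) ^ m + 2 * b n)) \<longlonglongrightarrow> C * ((1/3) ^ m + 2 * (17/18) ^ m)"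
        unfolding b_def by (intro tendsto_intros elim(2))
      then show ?thesis
        using m by (rule order_tendstoD)
    qed
    moreover have "\<forall>\<^sub>F n in sequentially. 2 * real m * B / real n < \<epsilon>/5"
    proof -
      have "(\<lambda>n. 2 * real m * B / real n) \<longlonglongrightarrow> 0"
        by (rule lim_const_over_n)
      then show ?thesis
        using \<open>\<epsilon> > 0\<close> by (intro order_tendstoD) auto
    qed
    ultimately have ev: "\<forall>\<^sub>F n in sequentially. n > 0 \<and> \<bar>a n - A\<bar> < \<epsilon>/5 \<and>
        C * ((1/3) ^ m + 2 * b n) < \<epsilon>/5 \<and> 2 * real m * B / real n < \<epsilon>/5"
      using eventually_gt_at_top[of 0] by eventually_elim simp
    show ?case
    proof (intro ballI impI)
      fix p assume p: "p \<in> generic_cube" and x: "fst p = x"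
      show "\<forall>\<^sub>F n in sequentially. \<bar>1 / real n * (\<Sum>i<n. \<phi> ((hc3 ^^ i) p)) - A\<bar> < \<epsilon>"
        using ev
      proof eventually_elim
        case (elim n)
        have "\<bar>(\<Sum>i<n. \<phi> ((hc3 ^^ (m + i)) p)) - (\<Sum>i<n. f ((T ^^ i) x))\<bar>
            \<le> (\<Sum>i<n. \<bar>\<phi> ((hc3 ^^ (m + i)) p) - f ((T ^^ i) x)\<bar>)"
          unfolding sum_subtractf[symmetric] by (rule sum_abs)
        also have "\<dots> \<le> (\<Sum>i<n. \<epsilon>/5 + C * ((1/3) ^ m + 2 * weight m ((T ^^ i) x)))"
        proof (rule sum_mono)
          fix i
          show "\<bar>\<phi> ((hc3 ^^ (m + i)) p) - f ((T ^^ i) x)\<bar>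
              \<le> \<epsilon>/5 + C * ((1/3) ^ m + 2 * weight m ((T ^^ i) x))"
            using step[OF hc3_funpow_generic_cube[OF p, of i]]
            by (simp add: funpow_add fst_hc3_funpow[OF p] x)
        qed
        also have "\<dots> = real n * (\<epsilon>/5 + C * ((1/3) ^ m + 2 * b n))"
        proof -
          have "(\<Sum>i<n. weight m ((T ^^ i) x)) = real n * b n"
            using elim by (simp add: b_def)
          then show ?thesis
            by (simp add: sum.distrib algebra_simps flip: sum_distrib_left)
        qed
        finally have "\<bar>(\<Sum>i<n. \<phi> ((hc3 ^^ (m + i)) p)) - real n * a n\<bar>
            \<le> real n * (\<epsilon>/5 + C * ((1/3) ^ m + 2 * b n))"
          using elim by (simp add: a_def)
        moreover have "\<bar>(\<Sum>i<n. \<phi> ((hc3 ^^ i) p)) - (\<Sum>i<n. \<phi> ((hc3 ^^ (m + i)) p))\<bar> \<le> 2 * real m * B"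
          by (intro sum_shift_bound B subsetD[OF generic_cube_subset] hc3_funpow_generic_cube p)
        ultimately have "\<bar>(\<Sum>i<n. \<phi> ((hc3 ^^ i) p)) - real n * a n\<bar>
            \<le> real n * (\<epsilon>/5 + C * ((1/3) ^ m + 2 * b n)) + 2 * real m * B"
          by linarith
        then have "\<bar>(\<Sum>i<n. \<phi> ((hc3 ^^ i) p)) - real n * a n\<bar> / real n
            \<le> (real n * (\<epsilon>/5 + C * ((1/3) ^ m + 2 * b n)) + 2 * real m * B) / real n"
          by (rule divide_right_mono) simp
        moreover have "\<bar>(\<Sum>i<n. \<phi> ((hc3 ^^ i) p)) - real n * a n\<bar> / real n
            = \<bar>((\<Sum>i<n. \<phi> ((hc3 ^^ i) p)) - real n * a n) / real n\<bar>"
          by simp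
        moreover have "((\<Sum>i<n. \<phi> ((hc3 ^^ i) p)) - real n * a n) / real n
            = 1 / real n * (\<Sum>i<n. \<phi> ((hc3 ^^ i) p)) - a n"
          using elim by (simp add: diff_divide_distrib)
        moreover have "(real n * (\<epsilon>/5 + C * ((1/3) ^ m + 2 * b n)) + 2 * real m * B) / real n
            = \<epsilon>/5 + C * ((1/3) ^ m + 2 * b n) + 2 * real m * B / real n"
          using elim by (simp add: add_divide_distrib)
        ultimately have "\<bar>1 / real n * (\<Sum>i<n. \<phi> ((hc3 ^^ i) p)) - a n\<bar>
            \<le> \<epsilon>/5 + C * ((1/3) ^ m + 2 * b n) + 2 * real m * B / real n"
          by simp
        then show ?case
          using elim by linarith
      qed
    qed
  qed
  then show ?thesis
    by blast
qed

text \<open>Two averages of the family, at late times, are both close to the same \<open>A k\<close>, hence close to each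
  other. With both taken at one point this says that the averages form a Cauchy sequence; with two
  points it says that the limits agree.\<close>

lemma common_limit:
  fixes s :: "'p \<Rightarrow> nat \<Rightarrow> real" and A :: "nat \<Rightarrow> real"
  assumes close: "\<And>p k. p \<in> P \<Longrightarrow> \<forall>\<^sub>F n in sequentially. \<bar>s p n - A k\<bar> < inverse (real (Suc k))"
  shows "\<exists>c. \<forall>p\<in>P. s p \<longlonglongrightarrow> c"
proof -
  have small: "\<exists>k. 2 * inverse (real (Suc k)) < e" if "e > 0" for e :: real
  proof -
    obtain k where "inverse (real (Suc k)) < e / 2"
      using reals_Archimedean[of "e / 2"] \<open>e > 0\<close> by auto
    then have "2 * inverse (real (Suc k)) < e"
      by linarith
    then show ?thesis ..
  qed
  have near: "\<exists>N. \<forall>m\<ge>N. \<forall>n\<ge>N. \<bar>s p m - s q n\<bar> < e" if "p \<in> P" "q \<in> P" "e > 0" for p q e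
  proof -
    obtain k where k: "2 * inverse (real (Suc k)) < e"
      using small[OF \<open>e > 0\<close>] by blast
    have "\<forall>\<^sub>F n in sequentially. \<bar>s p n - A k\<bar> < inverse (real (Suc k))
        \<and> \<bar>s q n - A k\<bar> < inverse (real (Suc k))"
      by (intro eventually_conj close that)
    then obtain N where N: "\<bar>s p n - A k\<bar> < inverse (real (Suc k))"
        "\<bar>s q n - A k\<bar> < inverse (real (Suc k))" if "n \<ge> N" for n
      unfolding eventually_sequentially by blast
    show ?thesis
    proof (intro exI allI impI)
      fix m n assume "m \<ge> N" "n \<ge> N"
      then show "\<bar>s p m - s q n\<bar> < e"
        using N(1)[of m] N(2)[of n] k by linarith
    qed
  qed
  show ?thesis
  proof (cases "P = {}")
    case False
    then obtain q where q: "q \<in> P"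
      by blast
    have "Cauchy (s q)"
      using near[OF q q] by (intro CauchyI) simp
    then obtain c where c: "s q \<longlonglongrightarrow> c"
      by (auto simp: Cauchy_convergent_iff convergent_def)
    have "s p \<longlonglongrightarrow> c" if "p \<in> P" for p
    proof -
      have "(\<lambda>n. s p n - s q n) \<longlonglongrightarrow> 0"
      proof (rule LIMSEQ_I)
        fix e :: real assume "e > 0"
        then show "\<exists>N. \<forall>n\<ge>N. norm (s p n - s q n - 0) < e"
          using near[OF that q, of e] by auto
      qed
      from tendsto_add[OF this c] show ?thesis
        by simp
    qed
    then show ?thesis
      by blast
  qed simp
qed

lemma generic_average_limit:
  assumes \<phi>: "continuous_on unit_cube \<phi>"
  shows "\<exists>c. AE x in U. \<forall>p\<in>generic_cube. fst p = x \<longrightarrow>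
    (\<lambda>n. 1 / real n * (\<Sum>i<n. \<phi> ((hc3 ^^ i) p))) \<longlonglongrightarrow> c"
proof -
  define s where "s p n = 1 / real n * (\<Sum>i<n. \<phi> ((hc3 ^^ i) p))" for p n
  define near where "near x A k \<longleftrightarrow> (\<forall>p\<in>generic_cube. fst p = x \<longrightarrow>
      (\<forall>\<^sub>F n in sequentially. \<bar>s p n - A\<bar> < inverse (real (Suc k))))" for x A k
  have "\<forall>k. \<exists>A. AE x in U. near x A k"
    unfolding near_def s_def by (intro allI average_eventually_close[OF \<phi>]) simp
  then obtain A where "\<And>k. AE x in U. near x (A k) k"
    by metis
  then have all: "AE x in U. \<forall>k. near x (A k) k"
    by (simp add: AE_all_countable)
  define P where "P = {p \<in> generic_cube. \<forall>k. near (fst p) (A k) k}"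
  obtain c where c: "\<forall>p\<in>P. s p \<longlonglongrightarrow> c"
    using common_limit[of P s A] by (auto simp: P_def near_def)
  from all have "AE x in U. \<forall>p\<in>generic_cube. fst p = x \<longrightarrow> s p \<longlonglongrightarrow> c"
    by eventually_elim (use c in \<open>auto simp: P_def\<close>)
  then show ?thesis
    unfolding s_def by blast
qed

section \<open>Ergodicity of the two maps\<close>

text \<open>A cylinder over a null set is a null set.\<close>

lemma AE_lborel_fst:
  assumes "AE x in lborel. Q x"
  shows "AE p in (lborel :: ('a::euclidean_space \<times> 'b::euclidean_space) measure). Q (fst p)"
proof -
  obtain N where N: "{x. \<not> Q x} \<subseteq> N" "emeasure lborel N = 0" "N \<in> sets lborel"
    using AE_E[OF assms] by auto
  have "emeasure (lborel \<Otimes>\<^sub>M lborel) (N \<times> (UNIV :: 'b set)) = emeasure lborel N * emeasure lborel (UNIV :: 'b set)"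
    using N(3) by (intro lborel.emeasure_pair_measure_Times) auto
  moreover have "N \<times> (UNIV :: 'b set) \<in> sets borel"
    unfolding borel_prod[symmetric] using N(3) by (intro pair_measureI) auto
  ultimately have "N \<times> (UNIV :: 'b set) \<in> null_sets lborel"
    using N(2) by (simp add: null_sets_def lborel_prod)
  then show ?thesis
    by (rule AE_I') (use N in auto)
qed

lemma AE_lborel_snd:
  assumes "AE x in lborel. Q x"
  shows "AE p in (lborel :: ('a::euclidean_space \<times> 'b::euclidean_space) measure). Q (snd p)"
proof -
  obtain N where N: "{x. \<not> Q x} \<subseteq> N" "emeasure lborel N = 0" "N \<in> sets lborel"
    using AE_E[OF assms] by auto
  have "emeasure (lborel \<Otimes>\<^sub>M lborel) ((UNIV :: 'a set) \<times> N) = emeasure lborel (UNIV :: 'a set) * emeasure lborel N"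
    using N(3) by (intro lborel.emeasure_pair_measure_Times) auto
  moreover have "(UNIV :: 'a set) \<times> N \<in> sets borel"
    unfolding borel_prod[symmetric] using N(3) by (intro pair_measureI) auto
  ultimately have "(UNIV :: 'a set) \<times> N \<in> null_sets lborel"
    using N(2) by (simp add: null_sets_def lborel_prod)
  then show ?thesis
    by (rule AE_I') (use N in auto)
qed

lemma AE_lebesgue_on_of_lborel:
  assumes "AE p in lborel. p \<in> M \<longrightarrow> Q p" and "M \<in> sets lebesgue"
  shows "AE p in lebesgue_on M. Q p"
  using AE_completion[OF assms(1)] assms(2) by (simp add: AE_restrict_space_iff)

lemma hc3_unit_cube: "hc3 \<in> unit_cube \<rightarrow> unit_cube"
proof
  fix p assume "p \<in> unit_cube"
  moreover have "0 \<le> tau x" "tau x \<le> 1" for x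
    using frac_lt_1[of "3 * x"] by (auto simp: tau_def)
  ultimately show "hc3 p \<in> unit_cube"
    by (cases p) (auto simp: unit_cube_def hc3_def region_A_def region_B_def region_C_def region_D_def)
qed

lemma proj_hc3: "p \<in> unit_cube \<Longrightarrow> proj_xz (hc3 p) = hc2 (proj_xz p)"
  by (cases p)
     (auto simp: unit_cube_def hc2_def hc3_def proj_xz_def region_A_def region_B_def region_C_def region_D_def)

lemma proj_hc3_funpow:
  assumes "p \<in> unit_cube"
  shows "(hc3 ^^ n) p \<in> unit_cube \<and> proj_xz ((hc3 ^^ n) p) = (hc2 ^^ n) (proj_xz p)"
  using assms hc3_unit_cube by (induction n) (auto simp: proj_hc3)

lemma proj_unit_cube: "p \<in> unit_cube \<Longrightarrow> proj_xz p \<in> unit_square"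
  by (auto simp: unit_cube_def unit_square_def proj_xz_def)

lemma hc2_unit_square: "hc2 \<in> unit_square \<rightarrow> unit_square"
proof
  fix q assume "q \<in> unit_square"
  then obtain x z where q: "q = (x, z)" and "(x, 0, z) \<in> unit_cube"
    by (auto simp: unit_square_def unit_cube_def)
  then show "hc2 q \<in> unit_square"
    using proj_unit_cube[of "hc3 (x, 0, z)"] hc3_unit_cube by (auto simp: hc2_def)
qed

lemma ergodic_map_hc3: "ergodic_map unit_cube hc3"
  unfolding ergodic_map_def
proof (intro conjI allI impI hc3_unit_cube)
  fix \<phi> :: "real \<times> real \<times> real \<Rightarrow> real"
  assume "continuous_on unit_cube \<phi>"
  from generic_average_limit[OF this] obtain c where
    "AE x in U. \<forall>p\<in>generic_cube. fst p = x \<longrightarrow>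
      (\<lambda>n. 1 / real n * (\<Sum>i<n. \<phi> ((hc3 ^^ i) p))) \<longlonglongrightarrow> c" ..
  then have "AE x in lborel. x \<in> {0..<1} \<longrightarrow> (\<forall>p\<in>generic_cube. fst p = x \<longrightarrow>
      (\<lambda>n. 1 / real n * (\<Sum>i<n. \<phi> ((hc3 ^^ i) p))) \<longlonglongrightarrow> c)"
    by (simp add: AE_restrict_space_iff)
  note AE_lborel_fst[OF this, where 'b = "real \<times> real"]
  moreover have "AE p in (lborel :: (real \<times> real \<times> real) measure). snd (snd p) \<noteq> 1"
    by (rule AE_lborel_snd[OF AE_lborel_snd[OF AE_lborel_singleton]])
  moreover have "AE p in (lborel :: (real \<times> real \<times> real) measure). fst p \<noteq> 1"
    by (rule AE_lborel_fst[OF AE_lborel_singleton])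
  ultimately have "AE p in lborel. p \<in> unit_cube \<longrightarrow>
      (\<lambda>n. 1 / real n * (\<Sum>i<n. \<phi> ((hc3 ^^ i) p))) \<longlonglongrightarrow> c"
    by eventually_elim (auto simp: unit_cube_def generic_cube_def)
  moreover have "unit_cube \<in> sets lebesgue"
    using compact_unit_cube by (intro sets_completionI_sets) (auto intro: borel_compact)
  ultimately have "AE p in lebesgue_on unit_cube.
      (\<lambda>n. 1 / real n * (\<Sum>i<n. \<phi> ((hc3 ^^ i) p))) \<longlonglongrightarrow> c"
    by (rule AE_lebesgue_on_of_lborel)
  then show "\<exists>c. AE p in lebesgue_on unit_cube.
      (\<lambda>n. 1 / real n * (\<Sum>i<n. \<phi> ((hc3 ^^ i) p))) \<longlonglongrightarrow> c" ..
qed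

text \<open>A trajectory of the two-dimensional map is the projection of the trajectory that starts at height
  \<open>y = 0\<close>. The plane \<open>y = 0\<close> is a null set of the cube, so the three-dimensional result does not apply as
  such; but the exceptional set is covered by planes on which \<open>x\<close> or \<open>z\<close> is constant, and their
  intersections with \<open>y = 0\<close> project to lines that form a null set in the square.\<close>

lemma ergodic_map_hc2: "ergodic_map unit_square hc2"
  unfolding ergodic_map_def
proof (intro conjI allI impI hc2_unit_square)
  fix \<phi> :: "real \<times> real \<Rightarrow> real"
  assume \<phi>: "continuous_on unit_square \<phi>"
  have "continuous_on unit_cube proj_xz"
    unfolding proj_xz_def split_beta by (intro continuous_intros)
  then have "continuous_on unit_cube (\<lambda>p. \<phi> (proj_xz p))"
    by (intro continuous_on_compose2[OF \<phi>]) (auto simp: proj_unit_cube)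
  from generic_average_limit[OF this] obtain c where
    "AE x in U. \<forall>p\<in>generic_cube. fst p = x \<longrightarrow>
      (\<lambda>n. 1 / real n * (\<Sum>i<n. \<phi> (proj_xz ((hc3 ^^ i) p)))) \<longlonglongrightarrow> c" ..
  then have "AE x in lborel. x \<in> {0..<1} \<longrightarrow> (\<forall>p\<in>generic_cube. fst p = x \<longrightarrow>
      (\<lambda>n. 1 / real n * (\<Sum>i<n. \<phi> (proj_xz ((hc3 ^^ i) p)))) \<longlonglongrightarrow> c)"
    by (simp add: AE_restrict_space_iff)
  note AE_lborel_fst[OF this, where 'b = real]
  moreover have "AE q in (lborel :: (real \<times> real) measure). snd q \<noteq> 1"
    by (rule AE_lborel_snd[OF AE_lborel_singleton])
  moreover have "AE q in (lborel :: (real \<times> real) measure). fst q \<noteq> 1"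
    by (rule AE_lborel_fst[OF AE_lborel_singleton])
  ultimately have "AE q in lborel. q \<in> unit_square \<longrightarrow>
      (\<lambda>n. 1 / real n * (\<Sum>i<n. \<phi> ((hc2 ^^ i) q))) \<longlonglongrightarrow> c"
  proof eventually_elim
    case (elim q)
    show ?case
    proof
      assume "q \<in> unit_square"
      define p where "p = (fst q, 0 :: real, snd q)"
      have "fst q \<in> {0..<1}" "p \<in> generic_cube"
        using elim \<open>q \<in> unit_square\<close> by (auto simp: p_def unit_square_def generic_cube_def)
      then have "(\<lambda>n. 1 / real n * (\<Sum>i<n. \<phi> (proj_xz ((hc3 ^^ i) p)))) \<longlonglongrightarrow> c"
        using elim by (auto simp: p_def)
      moreover have "proj_xz ((hc3 ^^ i) p) = (hc2 ^^ i) q" for i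
        using proj_hc3_funpow[of p i] generic_cube_subset \<open>p \<in> generic_cube\<close>
        by (auto simp: p_def proj_xz_def)
      ultimately show "(\<lambda>n. 1 / real n * (\<Sum>i<n. \<phi> ((hc2 ^^ i) q))) \<longlonglongrightarrow> c"
        by simp
    qed
  qed
  moreover have "unit_square \<in> sets lebesgue"
    unfolding unit_square_def
    by (intro sets_completionI_sets) (auto intro!: borel_compact compact_Times)
  ultimately have "AE q in lebesgue_on unit_square.
      (\<lambda>n. 1 / real n * (\<Sum>i<n. \<phi> ((hc2 ^^ i) q))) \<longlonglongrightarrow> c"
    by (rule AE_lebesgue_on_of_lborel)
  then show "\<exists>c. AE q in lebesgue_on unit_square.
      (\<lambda>n. 1 / real n * (\<Sum>i<n. \<phi> ((hc2 ^^ i) q))) \<longlonglongrightarrow> c" ..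
qed

theorem theorem1p2:
  shows "ergodic_map unit_square hc2 \<and> ergodic_map unit_cube hc3"
  using ergodic_map_hc2 ergodic_map_hc3 by blast

end
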